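(* Let $\gamma\in(0,1)$ and $\varepsilon\ge1$, and let $r\ge0$ be an integer. Suppose $f$ is of $\mathrm{Type}(\mu,\infty,\{0\})$ for some $\mu\in(-1,1)$, and $g\in C^\infty[0,1]$ satisfies: $g^{(j)}(0)=0$ for $j=0,\dots,r$; $g^{(r+1)}(x)\ne0$ for $x\in[0,1]$; $g$ is monotonically increasing with no inflection point in $[0,1]$; and there is a constant $\zeta>1$ such that $\max_{0\le j\le n}\max_{x\in[0,1]}|g^{(j)}(x)|\le\zeta$ for all $n\in\mathbb{N}$. Then there exists a positive constant $c$ such that for all $\kappa>1$ and all integers $s>1$ $$\left|\mathcal{I}^{\mu}[f,g]-\mathcal{Q}_{\gamma}^{s}[f,g]\right|\le c\,\kappa_{\sigma(r)}^{-(1+\mu)/(r+1)}\,\gamma^{(1+\mu)(s-1)-1},$$ and $\mathcal{N}\big(\mathcal{Q}_{\gamma}^{s}[f,g]\big)\le\lceil\varepsilon\rceil(s^2-s)$. In particular, if $g(x)=x$ for $x\in[0,1]$, then the upper bound in the displayed estimate reduces to $c\,\kappa^{-1-\mu}\gamma^{(1+\mu)(s-1)-1}$.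
   Context: $\mathbb{N}=\{1,2,\dots\}$. Type. A real-valued $f\in C^{\infty}((0,1])$ is of $\mathrm{Type}(\mu,\infty,\{0\})$ if there is a constant $c>0$ such that $|f^{(k)}(x)|\le c\,x^{\mu-k}$ for all $x\in(0,1]$ and all integers $k\ge0$. "No inflection point in $[0,1]$" means that $g'$ is monotone on $[0,1]$. $\sigma(r):=\max_{x\in[0,1]}|g^{(r+1)}(x)|/(r+1)!$; $\kappa_{\sigma(r)}:=\kappa$ if $\sigma(r)\le1$ and $\kappa_{\sigma(r)}:=\kappa\,\sigma(r)$ if $\sigma(r)>1$; $\lambda_r:=\kappa_{\sigma(r)}^{-1/(r+1)}$. $\varphi_\kappa(x):=f(\lambda_rx)\,e^{\mathrm{i}\kappa g(\lambda_rx)}$ and $\mathcal{I}^{\mu}[f,g]:=\lambda_r\int_0^1\varphi_\kappa(x)\,dx$ (which equals $\int_0^{\lambda_r}f(x)e^{\mathrm{i}\kappa g(x)}dx$). Quadrature. Let $\mathcal{Q}_m^{[a,b]}[\psi]$ denote the $m$-point Gauss–Legendre rule for $\int_a^b\psi(x)\,dx$. Put $x_0:=0$, $x_j:=\gamma^{s-j}$ for $j=1,\dots,s$, and $m_j:=\lceil j\varepsilon\rceil$ for $j=1,\dots,s-1$. Then $\mathcal{Q}_{\gamma}^{s}[f,g]:=\lambda_r\sum_{j=1}^{s-1}\mathcal{Q}_{m_j}^{[x_j,x_{j+1}]}[\varphi_\kappa]$ (the integral over $[x_0,x_1]$ is replaced by zero). $\mathcal{N}(F)$ denotes the number of evaluations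 of $\varphi_\kappa$ used in the formula $F$. *)

theory Defs
  imports "HOL-Analysis.Analysis" "HOL-Computational_Algebra.Polynomial"
begin

section \<open>Smooth functions on an interval\<close>

text \<open>Iterated derivatives relative to \<open>S\<close>, hence one-sided at endpoints belonging to \<open>S\<close>.
  Only the values of \<open>f\<close> on \<open>S\<close> matter for the values on \<open>S\<close>.\<close>

primrec nth_deriv :: "real set \<Rightarrow> nat \<Rightarrow> (real \<Rightarrow> real) \<Rightarrow> real \<Rightarrow> real" where
  "nth_deriv S 0 f = f"
| "nth_deriv S (Suc k) f = (\<lambda>x. vector_derivative (nth_deriv S k f) (at x within S))"

definition smooth_on :: "real set \<Rightarrow> (real \<Rightarrow> real) \<Rightarrow> bool" where
  "smooth_on S f \<longleftrightarrow> (\<forall>k. nth_deriv S k f differentiable_on S)"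

text \<open>\<open>Type(\<mu>, \<infinity>, {0})\<close>; the constant does not depend on the order \<open>k\<close>.\<close>

definition type_inf_0 :: "real \<Rightarrow> (real \<Rightarrow> real) \<Rightarrow> bool" where
  "type_inf_0 \<mu> f \<longleftrightarrow> smooth_on {0<..1} f \<and>
     (\<exists>c>0. \<forall>x\<in>{0<..1}. \<forall>k. \<bar>nth_deriv {0<..1} k f x\<bar> \<le> c * x powr (\<mu> - real k))"

text \<open>\<open>max |h|\<close> over \<open>[0,1]\<close>: the supremum is attained for continuous \<open>h\<close>, the only case in
  which it is used.\<close>

definition max_norm :: "(real \<Rightarrow> real) \<Rightarrow> real" where
  "max_norm h = (SUP x\<in>{0..1}. \<bar>h x\<bar>)"

definition no_inflection :: "(real \<Rightarrow> real) \<Rightarrow> bool" where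
  "no_inflection g \<longleftrightarrow>
     mono_on {0..1} (nth_deriv {0..1} 1 g) \<or> monotone_on {0..1} (\<le>) (\<ge>) (nth_deriv {0..1} 1 g)"

section \<open>The oscillatory integral\<close>

definition sigma :: "(real \<Rightarrow> real) \<Rightarrow> nat \<Rightarrow> real" where
  "sigma g r = max_norm (nth_deriv {0..1} (r + 1) g) / fact (r + 1)"

definition kappa_sigma :: "(real \<Rightarrow> real) \<Rightarrow> nat \<Rightarrow> real \<Rightarrow> real" where
  "kappa_sigma g r \<kappa> = (if sigma g r \<le> 1 then \<kappa> else \<kappa> * sigma g r)"

definition lambda :: "(real \<Rightarrow> real) \<Rightarrow> nat \<Rightarrow> real \<Rightarrow> real" where
  "lambda g r \<kappa> = kappa_sigma g r \<kappa> powr (- 1 / real (r + 1))"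

definition phi :: "(real \<Rightarrow> real) \<Rightarrow> (real \<Rightarrow> real) \<Rightarrow> nat \<Rightarrow> real \<Rightarrow> real \<Rightarrow> complex" where
  "phi f g r \<kappa> x = complex_of_real (f (lambda g r \<kappa> * x)) *
     exp (\<i> * complex_of_real (\<kappa> * g (lambda g r \<kappa> * x)))"

definition osc_integral :: "(real \<Rightarrow> real) \<Rightarrow> (real \<Rightarrow> real) \<Rightarrow> nat \<Rightarrow> real \<Rightarrow> complex" where
  "osc_integral f g r \<kappa> = complex_of_real (lambda g r \<kappa>) * integral {0..1} (phi f g r \<kappa>)"

section \<open>Quadrature formulas\<close>

text \<open>A quadrature formula is a list of (node, weight) pairs; each entry costs one evaluation
  of the integrand.\<close>

type_synonym quadrature = "(real \<times> real) list"

definition apply_quadrature :: "quadrature \<Rightarrow> (real \<Rightarrow> complex) \<Rightarrow> complex" where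
  "apply_quadrature F \<psi> = (\<Sum>(x, w)\<leftarrow>F. complex_of_real w * \<psi> x)"

definition num_evals :: "quadrature \<Rightarrow> nat" where
  "num_evals F = length F"

text \<open>Legendre polynomials (Rodrigues' formula).\<close>

definition legendre :: "nat \<Rightarrow> real poly" where
  "legendre m = smult (1 / (2 ^ m * fact m)) ((pderiv ^^ m) ([:-1, 0, 1:] ^ m))"

definition gauss_nodes :: "nat \<Rightarrow> real set" where
  "gauss_nodes m = {t. poly (legendre m) t = 0}"

text \<open>The weight of a node is the integral over \<open>[-1,1]\<close> of its Lagrange basis polynomial.\<close>

definition gauss_weight :: "nat \<Rightarrow> real \<Rightarrow> real" where
  "gauss_weight m t = integral {-1..1} (\<lambda>u. \<Prod>v\<in>gauss_nodes m - {t}. (u - v) / (t - v))"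

text \<open>The \<open>m\<close>-point Gauss--Legendre rule, transported affinely from \<open>[-1,1]\<close> to \<open>[a,b]\<close>.\<close>

definition gauss_legendre :: "nat \<Rightarrow> real \<Rightarrow> real \<Rightarrow> quadrature" where
  "gauss_legendre m a b =
     map (\<lambda>t. ((a + b) / 2 + (b - a) / 2 * t, (b - a) / 2 * gauss_weight m t))
       (sorted_list_of_set (gauss_nodes m))"

definition mesh :: "real \<Rightarrow> nat \<Rightarrow> nat \<Rightarrow> real" where
  "mesh \<gamma> s j = (if j = 0 then 0 else \<gamma> ^ (s - j))"

definition num_nodes :: "real \<Rightarrow> nat \<Rightarrow> nat" where
  "num_nodes \<epsilon> j = nat \<lceil>real j * \<epsilon>\<rceil>"

text \<open>The composite rule on the graded mesh has no nodes in the first cell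
  \<open>[mesh \<gamma> s 0, mesh \<gamma> s 1]\<close>.\<close>

definition composite_rule :: "real \<Rightarrow> real \<Rightarrow> nat \<Rightarrow> quadrature" where
  "composite_rule \<gamma> \<epsilon> s =
     concat (map (\<lambda>j. gauss_legendre (num_nodes \<epsilon> j) (mesh \<gamma> s j) (mesh \<gamma> s (j + 1))) [1..<s])"

definition osc_quadrature ::
    "real \<Rightarrow> real \<Rightarrow> nat \<Rightarrow> (real \<Rightarrow> real) \<Rightarrow> (real \<Rightarrow> real) \<Rightarrow> nat \<Rightarrow> real \<Rightarrow> complex" where
  "osc_quadrature \<gamma> \<epsilon> s f g r \<kappa> =
     complex_of_real (lambda g r \<kappa>) * apply_quadrature (composite_rule \<gamma> \<epsilon> s) (phi f g r \<kappa>)"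

end

theory Submission
  imports Defs "HOL-Complex_Analysis.Cauchy_Integral_Formula"
begin

text \<open>The bounds on the derivatives of \<open>f\<close> and \<open>g\<close> carry no factorial, so the Taylor series of
  \<open>f\<close> at \<open>1\<close> and of \<open>g\<close> at \<open>0\<close> converge everywhere: \<open>f\<close> and \<open>g\<close> are restrictions of entire
  functions \<open>F\<close> and \<open>G\<close>. Here \<open>F(z) = O(|z| ^ e)\<close> with an integer \<open>e \<in> {0, 1}\<close>, \<open>e \<ge> \<mu>\<close>, and
  \<open>G(z) = O(|z| ^ (r + 1))\<close>; since \<open>\<kappa> \<lambda> ^ (r + 1) \<le> 1\<close>, the entire integrand
  \<open>F(\<lambda> z) exp(i \<kappa> G(\<lambda> z))\<close> is \<open>O(\<lambda> ^ e |z| ^ e)\<close> on every fixed disc, uniformly in \<open>\<kappa>\<close>.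
  Cauchy's estimate on circles of radius \<open>\<gamma> ^ -3\<close> then bounds its derivatives. The exactness of
  degree \<open>2m - 1\<close> of the Gauss rule and the positivity of its weights are not needed: an
  \<open>m\<close>-point interpolatory rule with distinct nodes in a cell of length \<open>h\<close> has error
  \<open>O(h ^ (m + 1) \<gamma> ^ (3 m))\<close>, and with \<open>h \<le> \<gamma> ^ (s - j - 1)\<close> and \<open>m \<ge> j \<ge> 1\<close> this is
  \<open>O(\<gamma> ^ (2 (s - 1)) \<gamma> ^ j)\<close>, which is summable over the cells. The omitted first cell
  contributes \<open>O(\<gamma> ^ ((s - 1) (e + 1)))\<close>.\<close>

section \<open>Iterated Rolle theorem\<close>

text \<open>Induction that splits off the largest zero: Rolle between the two largest zeros gives a
  zero of \<open>F'\<close> to the right of all those supplied by the remaining set. The strict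
  inclusion in \<open>{Min Z<..<Max Z}\<close> keeps the new zeros distinct and away from the end
  points.\<close>

lemma Rolle_finite_set:
  fixes F F' :: "real \<Rightarrow> real"
  assumes deriv: "\<And>x. (F has_real_derivative F' x) (at x)"
    and "finite Z" "card Z = Suc k" "\<And>z. z \<in> Z \<Longrightarrow> F z = 0"
  obtains Z' where "finite Z'" "card Z' = k" "Z' \<subseteq> {Min Z<..<Max Z}" "\<And>z. z \<in> Z' \<Longrightarrow> F' z = 0"
proof -
  have "\<exists>Z'. finite Z' \<and> card Z' = k \<and> Z' \<subseteq> {Min Z<..<Max Z} \<and> (\<forall>z\<in>Z'. F' z = 0)"
    using assms(2-)
  proof (induction k arbitrary: Z)
    case 0
    show ?case by (rule exI[of _ "{}"]) simp
  next
    case (Suc k)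
    define b where "b = Max Z"
    define Z0 where "Z0 = Z - {b}"
    have "Z \<noteq> {}" using Suc.prems by auto
    hence b: "b \<in> Z" using Suc.prems unfolding b_def by (intro Max_in) auto
    have Z0: "finite Z0" "card Z0 = Suc k" "\<And>z. z \<in> Z0 \<Longrightarrow> F z = 0"
      using Suc.prems b by (auto simp: Z0_def)
    hence "Z0 \<noteq> {}" by auto
    define a where "a = Max Z0"
    have a: "a \<in> Z0" using Z0 \<open>Z0 \<noteq> {}\<close> unfolding a_def by (intro Max_in) auto
    have "a \<le> b" unfolding b_def using a Suc.prems by (intro Max_ge) (auto simp: Z0_def)
    moreover have "a \<noteq> b" using a by (auto simp: Z0_def)
    ultimately have "a < b" by simp
    have min: "Min Z \<le> Min Z0"
      using \<open>Z0 \<noteq> {}\<close> Suc.prems by (intro Min_antimono) (auto simp: Z0_def)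
    have mina: "Min Z0 \<le> a" using a Z0 by simp
    obtain Z' where Z': "finite Z'" "card Z' = k" "Z' \<subseteq> {Min Z0<..<Max Z0}" "\<forall>z\<in>Z'. F' z = 0"
      using Suc.IH[OF Z0] by blast
    have "\<exists>z. a < z \<and> z < b \<and> (*) (F' z) = (\<lambda>v. 0)"
    proof (rule Rolle_deriv[OF \<open>a < b\<close>])
      show "F a = F b" using a b Z0(3) Suc.prems(3) by simp
      show "continuous_on {a..b} F"
        using deriv by (intro DERIV_continuous_on) (auto intro: DERIV_subset)
      show "(F has_derivative (*) (F' x)) (at x)" for x
        using deriv[of x] by (simp add: has_field_derivative_def)
    qed
    then obtain c where c: "a < c" "c < b" "(*) (F' c) = (\<lambda>v. 0)" by blast
    have "F' c = 0" using fun_cong[OF c(3), of 1] by simp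
    have "c \<notin> Z'" using Z'(3) c(1) by (auto simp: a_def)
    show ?case
    proof (intro exI[of _ "insert c Z'"] conjI)
      show "card (insert c Z') = Suc k" using \<open>c \<notin> Z'\<close> Z' by simp
      show "insert c Z' \<subseteq> {Min Z<..<Max Z}"
        using Z'(3) c min mina \<open>a < b\<close> unfolding a_def[symmetric] b_def[symmetric] by force
    qed (use Z' \<open>F' c = 0\<close> in auto)
  qed
  thus thesis using that by blast
qed

text \<open>Each application of Rolle costs one zero and raises the order of the derivative by one,
  so \<open>Suc n\<close> zeros of \<open>D 0\<close> last until \<open>D n\<close>.\<close>

lemma Rolle_iterated:
  fixes D :: "nat \<Rightarrow> real \<Rightarrow> real"
  assumes deriv: "\<And>k x. (D k has_real_derivative D (Suc k) x) (at x)"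
    and "finite Z" "card Z = Suc n" "Z \<subseteq> {a..b}" "\<And>z. z \<in> Z \<Longrightarrow> D 0 z = 0"
  shows "\<exists>\<xi>\<in>{a..b}. D n \<xi> = 0"
  using assms
proof (induction n arbitrary: D Z)
  case 0
  then obtain z where "Z = {z}" by (auto simp: card_Suc_eq)
  thus ?case using 0 by auto
next
  case (Suc n)
  obtain Z' where Z': "finite Z'" "card Z' = Suc n" "Z' \<subseteq> {Min Z<..<Max Z}"
      "\<And>z. z \<in> Z' \<Longrightarrow> D (Suc 0) z = 0"
    using Rolle_finite_set[of "D 0" "D (Suc 0)" Z "Suc n"] Suc.prems by blast
  have "Z \<noteq> {}" using Suc.prems by auto
  hence "Min Z \<in> Z" "Max Z \<in> Z" using Suc.prems(2) by auto
  hence "Z' \<subseteq> {a..b}" using Z'(3) Suc.prems(4) by force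
  thus ?case using Suc.IH[of "\<lambda>k. D (Suc k)" Z'] Suc.prems(1) Z' by blast
qed

section \<open>Nodes of the Gauss--Legendre rule\<close>

lemma power_dvd_pderiv:
  fixes p q :: "'a :: idom poly"
  assumes "q ^ Suc n dvd p"
  shows "q ^ n dvd pderiv p"
proof -
  obtain s where s: "p = q ^ Suc n * s" using assms by (auto elim: dvdE)
  show ?thesis unfolding s pderiv_mult pderiv_power_Suc
    by (intro dvd_add dvd_mult dvd_mult2 dvd_smult) (auto simp: dvd_smult)
qed

text \<open>Used with \<open>q = x^2 - 1\<close>, where it shows that the derivatives of
  \<open>q ^ m\<close> of order below \<open>m\<close> still vanish at both ends of
  \<open>[-1,1]\<close>.\<close>

lemma power_dvd_higher_pderiv:
  fixes q :: "'a :: idom poly"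
  assumes "k \<le> m"
  shows "q ^ (m - k) dvd (pderiv ^^ k) (q ^ m)"
  using assms
proof (induction k)
  case (Suc k)
  hence "q ^ Suc (m - Suc k) dvd (pderiv ^^ k) (q ^ m)" by (simp add: Suc_diff_Suc)
  thus ?case using power_dvd_pderiv by simp
qed simp

text \<open>Induction on \<open>k\<close>: while \<open>k < m\<close>, the \<open>k\<close> interior
  roots and the end points \<open>-1\<close> and \<open>1\<close> are \<open>k + 2\<close> roots, so
  Rolle gives \<open>k + 1\<close> roots of the next derivative, all strictly inside.\<close>

lemma higher_pderiv_has_roots:
  fixes m k :: nat
  defines "p \<equiv> [:-1, 0, 1:] ^ m :: real poly"
  assumes "k \<le> m"
  shows "\<exists>Z. finite Z \<and> card Z = k \<and> Z \<subseteq> {-1<..<1} \<and> (\<forall>z\<in>Z. poly ((pderiv ^^ k) p) z = 0)"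
  using assms(2)
proof (induction k)
  case 0
  show ?case by (rule exI[of _ "{}"]) simp
next
  case (Suc k)
  then obtain Z where Z: "finite Z" "card Z = k" "Z \<subseteq> {-1<..<1}"
      "\<forall>z\<in>Z. poly ((pderiv ^^ k) p) z = 0" by auto
  define W where "W = insert (-1) (insert 1 Z)"
  have "card W = Suc (Suc k)" using Z by (auto simp: W_def card_insert_if)
  have end_roots: "poly ((pderiv ^^ k) p) z = 0" if "z\<^sup>2 = 1" for z
  proof -
    have "[:-1, 0, 1:] ^ (m - k) dvd (pderiv ^^ k) p"
      unfolding p_def using Suc.prems by (intro power_dvd_higher_pderiv) simp
    then obtain s where s: "(pderiv ^^ k) p = [:-1, 0, 1:] ^ (m - k) * s" by (auto elim: dvdE)
    have "poly [:-1, 0, 1:] z = 0" using that by (simp add: power2_eq_square)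
    thus ?thesis using Suc.prems by (simp add: s)
  qed
  have W: "finite W" "\<And>z. z \<in> W \<Longrightarrow> poly ((pderiv ^^ k) p) z = 0"
    using Z end_roots by (auto simp: W_def)
  obtain Z' where "finite Z'" "card Z' = Suc k" "Z' \<subseteq> {Min W<..<Max W}"
     "\<And>z. z \<in> Z' \<Longrightarrow> poly (pderiv ((pderiv ^^ k) p)) z = 0"
    using Rolle_finite_set[OF poly_DERIV W(1) \<open>card W = _\<close> W(2)] by blast
  moreover have "Min W = -1"
    by (rule Min_eqI) (use W(1) Z(3) in \<open>force simp: W_def\<close>)+
  moreover have "Max W = 1"
    by (rule Max_eqI) (use W(1) Z(3) in \<open>force simp: W_def\<close>)+
  ultimately show ?case by auto
qed

lemma degree_legendre: "degree (legendre m) = m"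
  by (simp add: legendre_def degree_higher_pderiv degree_power_eq)

lemma legendre_nonzero: "legendre m \<noteq> 0"
  using degree_legendre[of m] by (cases m) (auto simp: legendre_def)

lemma finite_gauss_nodes: "finite (gauss_nodes m)"
  unfolding gauss_nodes_def by (rule poly_roots_finite[OF legendre_nonzero])

text \<open>The \<open>m\<close> interior roots found by Rolle already exhaust the degree
  \<open>m\<close>.\<close>

lemma gauss_nodes_simple: "card (gauss_nodes m) = m \<and> gauss_nodes m \<subseteq> {-1<..<1}"
proof -
  obtain Z where Z: "finite Z" "card Z = m" "Z \<subseteq> {-1<..<1}"
      "\<forall>z\<in>Z. poly ((pderiv ^^ m) ([:-1, 0, 1:] ^ m)) z = (0::real)"
    using higher_pderiv_has_roots[of m m] by blast
  have sub: "Z \<subseteq> gauss_nodes m" using Z(4) by (auto simp: gauss_nodes_def legendre_def)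
  have "card (gauss_nodes m) \<le> m"
    using card_poly_roots_bound[OF legendre_nonzero, of m]
    by (simp add: gauss_nodes_def degree_legendre)
  hence "Z = gauss_nodes m"
    using sub Z(2) finite_gauss_nodes by (intro card_seteq) auto
  thus ?thesis using Z by blast
qed

section \<open>Error of the interpolatory rule\<close>

lemma poly_higher_pderiv_degree_le:
  fixes p :: "'a :: {comm_semiring_1,semiring_no_zero_divisors,semiring_char_0} poly"
  assumes "degree p \<le> n"
  shows "poly ((pderiv ^^ n) p) x = fact n * coeff p n"
proof -
  have "degree ((pderiv ^^ n) p) = 0" using assms by (simp add: degree_higher_pderiv)
  then obtain c where c: "(pderiv ^^ n) p = [:c:]" by (rule degree_eq_zeroE)
  have "c = fact n * coeff p n"
    using arg_cong[OF c, of "\<lambda>q. coeff q 0"] by (simp add: coeff_higher_pderiv flip: pochhammer_fact)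
  thus ?thesis by (simp add: c)
qed

lemma sum_lagrange_basis_node:
  fixes y :: "'a \<Rightarrow> 'a :: field"
  assumes "finite X" "u \<in> X"
  shows "(\<Sum>t\<in>X. y t * (\<Prod>v\<in>X - {t}. (u - v) / (t - v))) = y u"
proof -
  have "(\<Prod>v\<in>X - {t}. (u - v) / (t - v)) = (if t = u then 1 else 0)" if "t \<in> X" for t
  proof (cases "t = u")
    case False
    thus ?thesis using assms by (auto intro!: prod_zero)
  qed (auto intro!: prod.neutral split: if_splits)
  hence "(\<Sum>t\<in>X. y t * (\<Prod>v\<in>X - {t}. (u - v) / (t - v))) = (\<Sum>t\<in>X. if t = u then y u else 0)"
    by (intro sum.cong) auto
  thus ?thesis using assms by simp
qed

text \<open>The classical remainder: the error is \<open>D m \<xi> / fact m\<close> times the node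
  polynomial \<open>W\<close> at \<open>u\<close>, and each of the \<open>m\<close> factors of
  \<open>W\<close> is at most \<open>b - a\<close> in absolute value.\<close>

lemma interpolation_error:
  fixes D :: "nat \<Rightarrow> real \<Rightarrow> real"
  assumes deriv: "\<And>k x. (D k has_real_derivative D (Suc k) x) (at x)"
    and X: "finite X" "card X = m" "X \<subseteq> {a..b}" and u: "u \<in> {a..b}"
    and bound: "\<And>x. x \<in> {a..b} \<Longrightarrow> \<bar>D m x\<bar> \<le> B"
  shows "\<bar>D 0 u - (\<Sum>t\<in>X. D 0 t * (\<Prod>v\<in>X - {t}. (u - v) / (t - v)))\<bar> \<le> B / fact m * (b - a) ^ m"
proof (cases "u \<in> X")
  case True
  thus ?thesis using bound[OF u] u sum_lagrange_basis_node[OF X(1) True, of "D 0"] by simp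
next
  case False
  define L where "L t = (\<Prod>v\<in>X - {t}. smult (1 / (t - v)) [:-v, 1:])" for t
  define P where "P = (\<Sum>t\<in>X. smult (D 0 t) (L t))"
  define W where "W = (\<Prod>t\<in>X. [:-t, 1:])"
  have poly_L: "poly (L t) x = (\<Prod>v\<in>X - {t}. (x - v) / (t - v))" for t x
    by (simp add: L_def poly_prod diff_divide_distrib)
  have poly_P: "poly P x = (\<Sum>t\<in>X. D 0 t * (\<Prod>v\<in>X - {t}. (x - v) / (t - v)))" for x
    by (simp add: P_def poly_sum poly_L)
  have poly_W: "poly W x = (\<Prod>t\<in>X. x - t)" for x by (simp add: W_def poly_prod)
  have deg_L: "degree (L t) < m" if "t \<in> X" for t
  proof -
    have "degree (L t) \<le> (\<Sum>v\<in>X - {t}. degree (smult (1 / (t - v)) [:-v, 1:]))"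
      unfolding L_def using degree_prod_sum_le X(1) by (metis (no_types, lifting) comp_def finite_Diff sum.cong)
    also have "\<dots> \<le> (\<Sum>v\<in>X - {t}. 1)" by (intro sum_mono) (simp add: degree_smult_eq)
    also have "\<dots> < m" using X that by (metis card_Diff1_less card_eq_sum)
    finally show ?thesis .
  qed
  have coeff_P: "coeff P m = 0" unfolding P_def coeff_sum
    using deg_L by (intro sum.neutral ballI) (simp add: coeff_eq_0)
  have deg_P: "degree P \<le> m" unfolding P_def
    using deg_L X by (intro degree_sum_le) (auto intro: order_trans[OF degree_smult_le] less_imp_le)
  have deg_W: "degree W = m" unfolding W_def using X by (subst degree_prod_eq_sum_degree) auto
  have "lead_coeff W = 1" unfolding W_def by (subst lead_coeff_prod) simp
  hence coeff_W: "coeff W m = 1" by (simp add: deg_W)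
  have W_u: "poly W u \<noteq> 0" using False X(1) by (auto simp: poly_W)
  define K where "K = (D 0 u - poly P u) / poly W u"
  \<comment> \<open>\<open>K\<close> makes \<open>E 0\<close> vanish at \<open>u\<close> as well as at the \<open>m\<close> points of \<open>X\<close>.\<close>
  define E where "E k x = D k x - poly ((pderiv ^^ k) (P + smult K W)) x" for k x
  have "\<exists>\<xi>\<in>{a..b}. E m \<xi> = 0"
  proof (rule Rolle_iterated)
    show "(E k has_real_derivative E (Suc k) x) (at x)" for k x
      unfolding E_def by (auto intro!: derivative_eq_intros deriv poly_DERIV)
    show "card (insert u X) = Suc m" "finite (insert u X)" "insert u X \<subseteq> {a..b}"
      using X u False by auto
    fix z assume z: "z \<in> insert u X"
    show "E 0 z = 0"
    proof (cases "z = u")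
      case True
      thus ?thesis using W_u by (simp add: E_def K_def)
    next
      case False
      hence "z \<in> X" using z by simp
      have "poly P z = D 0 z"
        unfolding poly_P by (rule sum_lagrange_basis_node[OF X(1) \<open>z \<in> X\<close>])
      moreover have "poly W z = 0" using \<open>z \<in> X\<close> X by (auto simp: poly_W)
      ultimately show ?thesis by (simp add: E_def)
    qed
  qed
  then obtain \<xi> where \<xi>: "\<xi> \<in> {a..b}" "E m \<xi> = 0" by blast
  \<comment> \<open>\<open>P\<close> has degree below \<open>m\<close> or is zero, and
    \<open>W\<close> is monic of degree \<open>m\<close>, so only \<open>K\<close> survives.\<close>
  have "poly ((pderiv ^^ m) (P + smult K W)) \<xi> = fact m * K"
    using deg_P deg_W by (subst poly_higher_pderiv_degree_le)
      (auto simp: coeff_P coeff_W intro!: degree_add_le order_trans[OF degree_smult_le])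
  hence K: "K = D m \<xi> / fact m" using \<xi>(2) by (simp add: E_def)
  have "\<bar>poly W u\<bar> \<le> (\<Prod>t\<in>X. b - a)"
    unfolding poly_W abs_prod using X(3) u by (intro prod_mono) (force simp: abs_le_iff)
  hence W_le: "\<bar>poly W u\<bar> \<le> (b - a) ^ m" using X by simp
  have "D 0 u - poly P u = K * poly W u" using W_u by (simp add: K_def)
  hence "\<bar>D 0 u - poly P u\<bar> = \<bar>D m \<xi>\<bar> / fact m * \<bar>poly W u\<bar>" by (simp add: K abs_mult)
  also have "\<dots> \<le> B / fact m * (b - a) ^ m"
    using bound[OF \<xi>(1)] W_le by (intro mult_mono divide_right_mono divide_nonneg_nonneg) (auto intro: order_trans[OF abs_ge_zero])
  finally show ?thesis by (simp add: poly_P)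
qed

text \<open>The remainder formula rests on Rolle and hence is real; the factor \<open>c\<close> lets
  it serve both the real and the imaginary part of \<open>\<Psi>\<close>.\<close>

lemma entire_real_part_derivative:
  assumes "\<Psi> holomorphic_on UNIV"
  shows "((\<lambda>x. Re (c * (deriv ^^ k) \<Psi> (of_real x))) has_real_derivative
           Re (c * (deriv ^^ Suc k) \<Psi> (of_real x))) (at x)"
proof -
  have "((\<lambda>z. c * (deriv ^^ k) \<Psi> z) has_field_derivative c * (deriv ^^ Suc k) \<Psi> (of_real x)) (at (of_real x))"
    using has_field_derivative_higher_deriv[OF assms open_UNIV UNIV_I] by (rule DERIV_cmult)
  from has_vector_derivative_real_field[OF this]
  show ?thesis unfolding has_real_derivative_iff_has_vector_derivative
    by (rule bounded_linear.has_vector_derivative[OF bounded_linear_Re])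
qed

text \<open>Cauchy's estimate on circles of radius \<open>\<rho>\<close> about points of
  \<open>[-1,1]\<close> bounds the \<open>m\<close>-th derivative by
  \<open>fact m * M / \<rho> ^ m\<close>, and the factorial cancels in the interpolation remainder.
  The factor \<open>4\<close> is two, for real and imaginary part, times the length of the
  interval.\<close>

lemma gauss_error_reference:
  assumes holo: "\<Psi> holomorphic_on UNIV" and "\<rho> > 0"
    and bound: "\<And>z. norm z \<le> 1 + \<rho> \<Longrightarrow> norm (\<Psi> z) \<le> M"
  shows "norm (integral {-1..1} (\<lambda>u. \<Psi> (of_real u))
           - (\<Sum>t\<in>gauss_nodes m. of_real (gauss_weight m t) * \<Psi> (of_real t))) \<le> 4 * M * (2 / \<rho>) ^ m"
proof -
  define \<l> where "\<l> t u = (\<Prod>v\<in>gauss_nodes m - {t}. (u - v) / (t - v))" for t u :: real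
  define E where "E u = \<Psi> (of_real u) - (\<Sum>t\<in>gauss_nodes m. of_real (\<l> t u) * \<Psi> (of_real t))" for u :: real
  have Re_E: "\<bar>Re (c * E u)\<bar> \<le> M * (2 / \<rho>) ^ m" if u: "u \<in> {-1..1}" and c: "norm c = 1" for u c
  proof -
    define D where "D k x = Re (c * (deriv ^^ k) \<Psi> (of_real x))" for k x
    have "\<bar>D 0 u - (\<Sum>t\<in>gauss_nodes m. D 0 t * (\<Prod>v\<in>gauss_nodes m - {t}. (u - v) / (t - v)))\<bar>
            \<le> (fact m * M / \<rho> ^ m) / fact m * (1 - (-1)) ^ m"
    proof (rule interpolation_error)
      show "(D k has_real_derivative D (Suc k) x) (at x)" for k x
        unfolding D_def by (rule entire_real_part_derivative[OF holo])
      show "finite (gauss_nodes m)" "card (gauss_nodes m) = m" "gauss_nodes m \<subseteq> {-1..1}"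
        using finite_gauss_nodes gauss_nodes_simple by (auto simp: subset_iff intro: less_imp_le)
      fix x :: real assume x: "x \<in> {-1..1}"
      have "norm ((deriv ^^ m) \<Psi> (of_real x)) \<le> fact m * M / \<rho> ^ m"
      proof (rule Cauchy_inequality[OF _ _ \<open>\<rho> > 0\<close>])
        show "\<Psi> holomorphic_on ball (of_real x) \<rho>" using holo by (rule holomorphic_on_subset) simp
        show "continuous_on (cball (of_real x) \<rho>) \<Psi>"
          using holomorphic_on_imp_continuous_on[OF holo] by (rule continuous_on_subset) simp
        fix z :: complex assume "norm (of_real x - z) = \<rho>"
        moreover have "norm z \<le> norm (of_real x :: complex) + norm (of_real x - z)"
          by (metis norm_minus_commute norm_triangle_sub)
        ultimately show "norm (\<Psi> z) \<le> M" using x by (intro bound) auto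
      qed
      moreover have "\<bar>D m x\<bar> \<le> norm (c * (deriv ^^ m) \<Psi> (of_real x))"
        unfolding D_def by (rule abs_Re_le_cmod)
      ultimately show "\<bar>D m x\<bar> \<le> fact m * M / \<rho> ^ m" by (simp add: norm_mult c)
    qed (use u in auto)
    also have "D 0 u - (\<Sum>t\<in>gauss_nodes m. D 0 t * (\<Prod>v\<in>gauss_nodes m - {t}. (u - v) / (t - v))) = Re (c * E u)"
      by (simp add: E_def D_def \<l>_def[symmetric] algebra_simps sum_subtractf sum_distrib_left)
    finally show ?thesis by (simp add: power_divide)
  qed
  \<comment> \<open>The choice \<open>c = 1\<close> yields the real part of \<open>E u\<close>, and
    \<open>c = -\<i>\<close> the imaginary part.\<close>
  have norm_E: "norm (E u) \<le> 2 * M * (2 / \<rho>) ^ m" if "u \<in> {-1..1}" for u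
    using cmod_le[of "E u"] Re_E[OF that, of 1] Re_E[OF that, of "-\<i>"] by simp
  have cont_\<Psi>: "continuous_on {-1..1} (\<lambda>u. \<Psi> (of_real u))"
    by (intro continuous_on_compose2[OF holomorphic_on_imp_continuous_on[OF holo]] continuous_intros) simp
  have cont_\<l>: "continuous_on {-1..1} (\<l> t)" for t
    unfolding \<l>_def divide_inverse by (intro continuous_intros)
  have "((\<lambda>u. of_real (\<l> t u) * \<Psi> (of_real t)) has_integral of_real (gauss_weight m t) * \<Psi> (of_real t)) {-1..1}" for t
  proof -
    have "(\<l> t has_integral gauss_weight m t) {-1..1}"
      using integrable_integral[OF integrable_continuous_real[OF cont_\<l>[of t]]]
      by (simp add: gauss_weight_def \<l>_def[abs_def])
    from has_integral_linear[OF this, of "\<lambda>x. of_real x * \<Psi> (of_real t)"]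
    show ?thesis by (simp add: o_def bounded_linear_mult_const[OF bounded_linear_of_real])
  qed
  \<comment> \<open>The weights are the integrals of the basis polynomials, so the quadrature error
    is the integral of the interpolation error \<open>E\<close>.\<close>
  hence "(E has_integral (integral {-1..1} (\<lambda>u. \<Psi> (of_real u))
           - (\<Sum>t\<in>gauss_nodes m. of_real (gauss_weight m t) * \<Psi> (of_real t)))) {-1..1}"
    unfolding E_def using integrable_continuous_real[OF cont_\<Psi>] finite_gauss_nodes
    by (intro has_integral_diff has_integral_sum integrable_integral) auto
  hence "integral {-1..1} E = integral {-1..1} (\<lambda>u. \<Psi> (of_real u))
           - (\<Sum>t\<in>gauss_nodes m. of_real (gauss_weight m t) * \<Psi> (of_real t))"
    by (rule integral_unique)
  moreover have "norm (integral {-1..1} E) \<le> 2 * M * (2 / \<rho>) ^ m * (1 - (-1))"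
    using norm_E cont_\<Psi> cont_\<l> unfolding E_def by (intro integral_bound) (auto intro!: continuous_intros)
  ultimately show ?thesis by simp
qed

section \<open>Affine transport of the error bound to a cell\<close>

lemma apply_gauss_legendre:
  "apply_quadrature (gauss_legendre m a b) \<psi> =
     (\<Sum>t\<in>gauss_nodes m. of_real ((b - a) / 2 * gauss_weight m t) * \<psi> ((a + b) / 2 + (b - a) / 2 * t))"
  using finite_gauss_nodes[of m]
  by (simp add: apply_quadrature_def gauss_legendre_def o_def sum_list_distinct_conv_sum_set)

text \<open>The substitution \<open>x = q + h * u\<close> reduces to the reference interval with
  \<open>\<rho> = R / h\<close>: the disc of radius \<open>1 + R / h\<close> about \<open>0\<close>
  becomes the disc of radius \<open>h + R\<close> about the midpoint.\<close>

lemma gauss_error: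
  assumes holo: "\<Phi> holomorphic_on UNIV" and "R > 0" "a < b"
    and bound: "\<And>z. norm (z - of_real ((a + b) / 2)) \<le> (b - a) / 2 + R \<Longrightarrow> norm (\<Phi> z) \<le> M"
  shows "norm (integral {a..b} (\<lambda>x. \<Phi> (of_real x)) - apply_quadrature (gauss_legendre m a b) (\<lambda>x. \<Phi> (of_real x)))
           \<le> 2 * M * (b - a) * ((b - a) / R) ^ m"
proof -
  define h where "h = (b - a) / 2"
  define q where "q = (a + b) / 2"
  have "h > 0" using \<open>a < b\<close> by (simp add: h_def)
  define \<Psi> where "\<Psi> z = \<Phi> (of_real q + of_real h * z)" for z
  have holo': "\<Psi> holomorphic_on UNIV"
    unfolding \<Psi>_def by (intro holomorphic_on_compose_gen[OF _ holo, unfolded o_def] holomorphic_intros) simp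
  have "norm (integral {-1..1} (\<lambda>u. \<Psi> (of_real u))
           - (\<Sum>t\<in>gauss_nodes m. of_real (gauss_weight m t) * \<Psi> (of_real t))) \<le> 4 * M * (2 / (R / h)) ^ m"
  proof (rule gauss_error_reference[OF holo'])
    show "norm (\<Psi> z) \<le> M" if "norm z \<le> 1 + R / h" for z
      unfolding \<Psi>_def
    proof (rule bound)
      have "h * norm z \<le> h * (1 + R / h)" using that \<open>h > 0\<close> by (intro mult_left_mono) auto
      thus "norm (of_real q + of_real h * z - of_real ((a + b) / 2)) \<le> (b - a) / 2 + R"
        using \<open>h > 0\<close> by (simp add: norm_mult q_def[symmetric] h_def[symmetric] distrib_left)
    qed
  qed (use \<open>R > 0\<close> \<open>h > 0\<close> in auto)
  hence "h * norm (integral {-1..1} (\<lambda>u. \<Psi> (of_real u))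
           - (\<Sum>t\<in>gauss_nodes m. of_real (gauss_weight m t) * \<Psi> (of_real t))) \<le> h * (4 * M * (2 / (R / h)) ^ m)"
    using \<open>h > 0\<close> by (intro mult_left_mono) auto
  also have "h * norm (integral {-1..1} (\<lambda>u. \<Psi> (of_real u))
           - (\<Sum>t\<in>gauss_nodes m. of_real (gauss_weight m t) * \<Psi> (of_real t)))
        = norm (of_real h * (integral {-1..1} (\<lambda>u. \<Psi> (of_real u))
           - (\<Sum>t\<in>gauss_nodes m. of_real (gauss_weight m t) * \<Psi> (of_real t))))"
    using \<open>h > 0\<close> by (simp add: norm_mult)
  also have "of_real h * (integral {-1..1} (\<lambda>u. \<Psi> (of_real u))
           - (\<Sum>t\<in>gauss_nodes m. of_real (gauss_weight m t) * \<Psi> (of_real t)))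
      = integral {a..b} (\<lambda>x. \<Phi> (of_real x)) - apply_quadrature (gauss_legendre m a b) (\<lambda>x. \<Phi> (of_real x))"
  proof -
    have "continuous_on (cbox a b) (\<lambda>x. \<Phi> (of_real x))"
      by (intro continuous_on_compose2[OF holomorphic_on_imp_continuous_on[OF holo]] continuous_intros) simp
    hence "((\<lambda>x. \<Phi> (of_real x)) has_integral integral (cbox a b) (\<lambda>x. \<Phi> (of_real x))) (cbox a b)"
      by (intro integrable_integral integrable_continuous)
    from has_integral_affinity'[OF this \<open>h > 0\<close>, of q]
    have "((\<lambda>x. \<Psi> (of_real x)) has_integral integral {a..b} (\<lambda>x. \<Phi> (of_real x)) /\<^sub>R h)
            {(a - q) / h .. (b - q) / h}"
      by (simp add: \<Psi>_def add.commute divide_inverse mult.commute)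
    moreover have "(a - q) / h = -1" "(b - q) / h = 1"
      using \<open>a < b\<close> by (simp_all add: q_def h_def field_simps)
    ultimately have "integral {-1..1} (\<lambda>x. \<Psi> (of_real x)) = integral {a..b} (\<lambda>x. \<Phi> (of_real x)) /\<^sub>R h"
      by (simp add: integral_unique)
    hence "of_real h * integral {-1..1} (\<lambda>x. \<Psi> (of_real x)) = integral {a..b} (\<lambda>x. \<Phi> (of_real x))"
      using \<open>h > 0\<close> by (simp add: scaleR_conv_of_real)
    moreover have "of_real h * (\<Sum>t\<in>gauss_nodes m. of_real (gauss_weight m t) * \<Psi> (of_real t))
        = apply_quadrature (gauss_legendre m a b) (\<lambda>x. \<Phi> (of_real x))"
      by (simp add: apply_gauss_legendre sum_distrib_left \<Psi>_def mult_ac flip: h_def q_def)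
    ultimately show ?thesis by (simp only: right_diff_distrib)
  qed
  also have "2 / (R / h) = (b - a) / R" using \<open>R > 0\<close> by (simp add: h_def field_simps)
  also have "h * (4 * M * ((b - a) / R) ^ m) = 2 * M * (b - a) * ((b - a) / R) ^ m"
    by (simp add: h_def)
  finally show ?thesis .
qed

section \<open>The composite rule on the graded mesh\<close>

lemma apply_quadrature_append: "apply_quadrature (F @ G) \<psi> = apply_quadrature F \<psi> + apply_quadrature G \<psi>"
  by (simp add: apply_quadrature_def)

lemma apply_quadrature_concat_map:
  "apply_quadrature (concat (map Q [m..<n])) \<psi> = (\<Sum>j\<in>{m..<n}. apply_quadrature (Q j) \<psi>)"
proof -
  have "apply_quadrature (concat (map Q js)) \<psi> = (\<Sum>j\<leftarrow>js. apply_quadrature (Q j) \<psi>)" for js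
    by (induction js) (simp_all add: apply_quadrature_append, simp add: apply_quadrature_def)
  thus ?thesis by (simp add: interv_sum_list_conv_sum_set_nat)
qed

lemma apply_quadrature_cong:
  assumes "\<And>x w. (x, w) \<in> set F \<Longrightarrow> \<psi> x = \<psi>' x"
  shows "apply_quadrature F \<psi> = apply_quadrature F \<psi>'"
  unfolding apply_quadrature_def using assms by (intro arg_cong[of _ _ sum_list] map_cong) auto

lemma mesh_Suc:
  assumes "0 < \<gamma>" "\<gamma> < 1" "1 \<le> j" "j < s"
  shows "0 < mesh \<gamma> s j" "mesh \<gamma> s j < mesh \<gamma> s (j + 1)" "mesh \<gamma> s (j + 1) \<le> 1"
proof -
  have "Suc (s - Suc j) = s - j" using assms by simp
  hence "\<gamma> ^ (s - j) = \<gamma> * \<gamma> ^ (s - Suc j)" by (metis power_Suc)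
  thus "mesh \<gamma> s j < mesh \<gamma> s (j + 1)" using assms by (simp add: mesh_def)
qed (use assms in \<open>auto simp: mesh_def power_le_one\<close>)

text \<open>Gauss nodes are interior to their cells, so the rule samples the integrand only where
  \<open>f\<close> is controlled, never at \<open>0\<close>.\<close>

lemma composite_rule_nodes:
  assumes "0 < \<gamma>" "\<gamma> < 1" "(x, w) \<in> set (composite_rule \<gamma> \<epsilon> s)"
  shows "x \<in> {0<..1}"
proof -
  obtain j t where j: "1 \<le> j" "j < s" and t: "t \<in> gauss_nodes (num_nodes \<epsilon> j)"
    and x: "x = (mesh \<gamma> s j + mesh \<gamma> s (j + 1)) / 2 + (mesh \<gamma> s (j + 1) - mesh \<gamma> s j) / 2 * t"
    using assms(3) finite_gauss_nodes by (auto simp: composite_rule_def gauss_legendre_def)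
  define h where "h = (mesh \<gamma> s (j + 1) - mesh \<gamma> s j) / 2"
  note mesh = mesh_Suc[OF assms(1,2) j]
  have "h > 0" using mesh by (simp add: h_def)
  have "t \<in> {-1<..<1}" using t gauss_nodes_simple by blast
  hence "-1 < t" "t < 1" by auto
  hence "h * (-1) < h * t" "h * t < h * 1" using \<open>h > 0\<close> by (simp_all only: mult_less_cancel_left_pos)
  thus ?thesis using mesh unfolding x h_def[symmetric] by (auto simp: h_def field_simps)
qed

lemma num_evals_composite_rule:
  assumes "1 \<le> \<epsilon>"
  shows "int (num_evals (composite_rule \<gamma> \<epsilon> s)) \<le> \<lceil>\<epsilon>\<rceil> * ((int s)\<^sup>2 - int s)"
proof -
  have len: "length (gauss_legendre m a b) = m" for m a b
    using gauss_nodes_simple[of m] by (simp add: gauss_legendre_def)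
  have "int (num_nodes \<epsilon> j) \<le> \<lceil>\<epsilon>\<rceil> * int j" for j
  proof -
    have "real j * \<epsilon> \<le> real j * real_of_int \<lceil>\<epsilon>\<rceil>" by (intro mult_left_mono) auto
    hence "real j * \<epsilon> \<le> real_of_int (\<lceil>\<epsilon>\<rceil> * int j)" by (simp add: mult.commute)
    thus ?thesis using assms by (simp add: num_nodes_def ceiling_le_iff)
  qed
  moreover have "int (num_evals (composite_rule \<gamma> \<epsilon> s)) = (\<Sum>j\<in>{1..<s}. int (num_nodes \<epsilon> j))"
    by (simp add: num_evals_def composite_rule_def length_concat o_def len interv_sum_list_conv_sum_set_nat)
  ultimately have "int (num_evals (composite_rule \<gamma> \<epsilon> s)) \<le> (\<Sum>j\<in>{1..<s}. \<lceil>\<epsilon>\<rceil> * int j)"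
    by (simp add: sum_mono)
  \<comment> \<open>Replacing \<open>j\<close> by \<open>s\<close> loses about a factor of two, and
    the \<open>s - 1\<close> equal terms give exactly \<open>s^2 - s\<close>.\<close>
  also have "\<dots> \<le> (\<Sum>j\<in>{1..<s}. \<lceil>\<epsilon>\<rceil> * int s)" using assms by (intro sum_mono mult_left_mono) auto
  also have "\<dots> \<le> \<lceil>\<epsilon>\<rceil> * ((int s)\<^sup>2 - int s)"
    by (cases s) (auto simp: power2_eq_square algebra_simps)
  finally show ?thesis .
qed

section \<open>Summing the errors of the cells\<close>

lemma integral_sum_adjacent:
  fixes \<psi> :: "real \<Rightarrow> 'a :: banach" and x :: "nat \<Rightarrow> real"
  assumes cont: "continuous_on UNIV \<psi>" and "m \<le> n"
    and mono: "\<And>j. m \<le> j \<Longrightarrow> j < n \<Longrightarrow> x j \<le> x (Suc j)"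
  shows "x m \<le> x n \<and> integral {x m..x n} \<psi> = (\<Sum>j\<in>{m..<n}. integral {x j..x (Suc j)} \<psi>)"
  using \<open>m \<le> n\<close> mono
proof (induction n rule: dec_induct)
  case (step n)
  have IH: "x m \<le> x n" "integral {x m..x n} \<psi> = (\<Sum>j\<in>{m..<n}. integral {x j..x (Suc j)} \<psi>)"
    using step.IH step.prems by auto
  have le: "x n \<le> x (Suc n)" using step by simp
  have "\<psi> integrable_on {x m..x (Suc n)}"
    by (intro integrable_continuous_real continuous_on_subset[OF cont]) simp
  from Henstock_Kurzweil_Integration.integral_combine[OF IH(1) le this] show ?case using IH le step.hyps by simp
qed simp

text \<open>The first summand bounds the integral over the omitted cell, of length
  \<open>\<gamma> ^ (s - 1)\<close>. The second comes from \<open>gauss_error\<close> with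
  \<open>R = 1 / \<gamma> ^ 3\<close> on each remaining cell, summed as a geometric series so that
  the constant does not depend on \<open>s\<close>.\<close>

lemma composite_error:
  assumes \<gamma>: "0 < \<gamma>" "\<gamma> < 1" and "1 \<le> \<epsilon>" "1 < s"
    and holo: "\<Phi> holomorphic_on UNIV"
    and bound: "\<And>z. norm z \<le> 1 + 1 / \<gamma> ^ 3 \<Longrightarrow> norm (\<Phi> z) \<le> M"
    and near_0: "\<And>x. 0 \<le> x \<Longrightarrow> x \<le> 1 \<Longrightarrow> norm (\<Phi> (of_real x)) \<le> M * x ^ e"
  shows "norm (integral {0..1} (\<lambda>x. \<Phi> (of_real x)) - apply_quadrature (composite_rule \<gamma> \<epsilon> s) (\<lambda>x. \<Phi> (of_real x)))
           \<le> M * \<gamma> ^ ((s - 1) * (e + 1)) + 2 * M * \<gamma> ^ (2 * (s - 1)) / (1 - \<gamma>)"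
proof -
  define \<psi> where "\<psi> x = \<Phi> (of_real x)" for x :: real
  define x where "x = mesh \<gamma> s"
  have "M \<ge> 0" using order_trans[OF norm_ge_zero bound[of 0]] \<gamma> by simp
  have cont: "continuous_on UNIV \<psi>" unfolding \<psi>_def
    by (intro continuous_on_compose2[OF holomorphic_on_imp_continuous_on[OF holo]] continuous_intros) simp
  note mesh = mesh_Suc[OF \<gamma>, of _ s, folded x_def]
  have xs: "x s = 1" "x 1 = \<gamma> ^ (s - 1)" using \<open>1 < s\<close> by (simp_all add: x_def mesh_def)
  have x1: "0 \<le> x 1" "x 1 \<le> 1" unfolding xs using \<gamma> by (simp_all add: power_le_one)
  have "x 1 \<le> x s \<and> integral {x 1..x s} \<psi> = (\<Sum>j\<in>{1..<s}. integral {x j..x (Suc j)} \<psi>)"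
    by (rule integral_sum_adjacent[OF cont]) (use \<open>1 < s\<close> mesh in \<open>auto intro: less_imp_le\<close>)
  moreover have "integral {0..x 1} \<psi> + integral {x 1..1} \<psi> = integral {0..1} \<psi>"
    using x1 by (intro Henstock_Kurzweil_Integration.integral_combine integrable_continuous_real continuous_on_subset[OF cont]) auto
  ultimately have split: "integral {0..1} \<psi> = integral {0..x 1} \<psi> + (\<Sum>j\<in>{1..<s}. integral {x j..x (Suc j)} \<psi>)"
    by (simp add: xs)
  define err where "err j = integral {x j..x (Suc j)} \<psi>
      - apply_quadrature (gauss_legendre (num_nodes \<epsilon> j) (x j) (x (j + 1))) \<psi>" for j
  have first: "norm (integral {0..x 1} \<psi>) \<le> M * \<gamma> ^ ((s - 1) * (e + 1))"
  proof -
    have "norm (integral {0..x 1} \<psi>) \<le> M * x 1 ^ e * (x 1 - 0)"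
    proof (rule integral_bound)
      fix t assume t: "t \<in> {0..x 1}"
      hence "M * t ^ e \<le> M * x 1 ^ e" using \<open>M \<ge> 0\<close> by (intro mult_left_mono power_mono) auto
      thus "norm (\<psi> t) \<le> M * x 1 ^ e" using near_0[of t] t x1 by (simp add: \<psi>_def)
    qed (use x1 continuous_on_subset[OF cont] in auto)
    also have "\<dots> = M * x 1 ^ (e + 1)" by simp
    also have "\<dots> = M * \<gamma> ^ ((s - 1) * (e + 1))" by (simp only: xs power_mult)
    finally show ?thesis .
  qed
  have cell: "norm (err j) \<le> 2 * M * \<gamma> ^ (2 * (s - 1)) * \<gamma> ^ j" if j: "j \<in> {1..<s}" for j
  proof -
    define n where "n = num_nodes \<epsilon> j"
    define h where "h = x (j + 1) - x j"
    note mesh_j = mesh[of j]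
    have "h > 0" using mesh_j j by (simp add: h_def)
    have h_le: "h \<le> \<gamma> ^ (s - (j + 1))"
      using mesh_j j by (simp add: h_def x_def mesh_def)
    have "real j * 1 \<le> real j * \<epsilon>" using \<open>1 \<le> \<epsilon>\<close> by (intro mult_left_mono) auto
    hence "j \<le> n" unfolding n_def num_nodes_def by linarith
    have "norm (err j) \<le> 2 * M * h * (h / (1 / \<gamma> ^ 3)) ^ n"
      unfolding err_def \<psi>_def n_def h_def Suc_eq_plus1
    proof (rule gauss_error[OF holo])
      fix z :: complex assume *: "norm (z - of_real ((x j + x (j + 1)) / 2)) \<le> (x (j + 1) - x j) / 2 + 1 / \<gamma> ^ 3"
      have "norm (of_real ((x j + x (j + 1)) / 2) :: complex) = (x j + x (j + 1)) / 2"
        using mesh_j j by (simp only: norm_of_real) auto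
      hence "norm z \<le> (x j + x (j + 1)) / 2 + (x (j + 1) - x j) / 2 + 1 / \<gamma> ^ 3"
        using * norm_triangle_sub[of z "of_real ((x j + x (j + 1)) / 2)"] by linarith
      also have "\<dots> = x (j + 1) + 1 / \<gamma> ^ 3" by (simp add: field_simps)
      also have "\<dots> \<le> 1 + 1 / \<gamma> ^ 3" using mesh_j j by simp
      finally show "norm (\<Phi> z) \<le> M" by (rule bound)
    qed (use mesh_j j \<gamma> in auto)
    also have "\<dots> = 2 * M * (h * (h * \<gamma> ^ 3) ^ n)" by simp
    also have "\<dots> \<le> 2 * M * (\<gamma> ^ (2 * (s - 1)) * \<gamma> ^ j)"
    proof (intro mult_left_mono)
      have h1: "h \<le> 1" using mesh_j j by (simp add: h_def)
      have "h * \<gamma> ^ 3 \<le> 1" using h1 \<gamma> \<open>h > 0\<close> by (intro mult_le_one) (auto simp: power_le_one)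
      hence "h * (h * \<gamma> ^ 3) ^ n \<le> h * (h * \<gamma> ^ 3) ^ j"
        using \<open>h > 0\<close> \<gamma> \<open>j \<le> n\<close> by (intro mult_left_mono power_decreasing) auto
      also have "\<dots> = h ^ Suc j * \<gamma> ^ (3 * j)" by (simp add: power_mult_distrib power_mult)
      \<comment> \<open>Two powers of \<open>h\<close> suffice, and they are available since
        \<open>j \<ge> 1\<close>. They contribute the exponent \<open>2 * (s - 1) - 2 * j\<close>;
        the factor \<open>\<gamma> ^ (3 * j)\<close> makes up for the deficit and leaves
        \<open>\<gamma> ^ j\<close> for the summation over the cells.\<close>
      also have "\<dots> \<le> h ^ 2 * \<gamma> ^ (3 * j)"
        using h1 \<open>h > 0\<close> \<gamma> j by (intro mult_right_mono power_decreasing) auto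
      also have "\<dots> \<le> (\<gamma> ^ (s - (j + 1))) ^ 2 * \<gamma> ^ (3 * j)"
        using h_le \<open>h > 0\<close> \<gamma> by (intro mult_right_mono power_mono) auto
      also have "\<dots> = \<gamma> ^ ((s - (j + 1)) * 2 + 3 * j)" by (simp add: power_mult power_add)
      also have "(s - (j + 1)) * 2 + 3 * j = 2 * (s - 1) + j" using j by auto
      finally show "h * (h * \<gamma> ^ 3) ^ n \<le> \<gamma> ^ (2 * (s - 1)) * \<gamma> ^ j" by (simp add: power_add)
    qed (use \<open>M \<ge> 0\<close> in auto)
    finally show ?thesis by (simp add: mult_ac)
  qed
  have "apply_quadrature (composite_rule \<gamma> \<epsilon> s) \<psi>
      = (\<Sum>j\<in>{1..<s}. apply_quadrature (gauss_legendre (num_nodes \<epsilon> j) (x j) (x (j + 1))) \<psi>)"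
    unfolding composite_rule_def x_def by (rule apply_quadrature_concat_map)
  hence "integral {0..1} \<psi> - apply_quadrature (composite_rule \<gamma> \<epsilon> s) \<psi> = integral {0..x 1} \<psi> + (\<Sum>j\<in>{1..<s}. err j)"
    by (simp add: split err_def sum_subtractf)
  also have "norm \<dots> \<le> norm (integral {0..x 1} \<psi>) + (\<Sum>j\<in>{1..<s}. norm (err j))"
    by (intro order_trans[OF norm_triangle_ineq] add_left_mono norm_sum)
  also have "\<dots> \<le> M * \<gamma> ^ ((s - 1) * (e + 1)) + (\<Sum>j\<in>{1..<s}. 2 * M * \<gamma> ^ (2 * (s - 1)) * \<gamma> ^ j)"
    using first cell by (intro add_mono sum_mono)
  also have "\<dots> \<le> M * \<gamma> ^ ((s - 1) * (e + 1)) + 2 * M * \<gamma> ^ (2 * (s - 1)) / (1 - \<gamma>)"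
  proof -
    have "(\<Sum>j\<in>{1..<s}. \<gamma> ^ j) \<le> (\<Sum>j. \<gamma> ^ j)"
      using \<gamma> by (intro sum_le_suminf summable_geometric) auto
    also have "\<dots> = 1 / (1 - \<gamma>)" using \<gamma> by (intro suminf_geometric) auto
    finally have "2 * M * \<gamma> ^ (2 * (s - 1)) * (\<Sum>j\<in>{1..<s}. \<gamma> ^ j) \<le> 2 * M * \<gamma> ^ (2 * (s - 1)) * (1 / (1 - \<gamma>))"
      using \<open>M \<ge> 0\<close> \<gamma> by (intro mult_left_mono) auto
    thus ?thesis by (simp add: sum_distrib_left)
  qed
  finally show ?thesis by (simp add: \<psi>_def[abs_def])
qed

section \<open>Entire extensions\<close>

text \<open>With \<open>a\<close> the derivatives of a function at \<open>w\<close>, this is its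
  Taylor series about \<open>w\<close> in the variable \<open>z - w\<close>. It is entire as soon as
  \<open>a\<close> is bounded.\<close>

definition exp_gen_fun :: "(nat \<Rightarrow> real) \<Rightarrow> complex \<Rightarrow> complex" where
  "exp_gen_fun a z = (\<Sum>k. of_real (a k / fact k) * z ^ k)"

context
  fixes a :: "nat \<Rightarrow> real" and c :: real
  assumes bounded: "\<And>k. \<bar>a k\<bar> \<le> c"
begin

lemma norm_exp_gen_fun_term: "norm (of_real (a k / fact k) * z ^ k :: complex) = \<bar>a k\<bar> / fact k * norm z ^ k"
  by (simp add: norm_mult norm_power norm_divide)

lemma exp_gen_fun_summable: "summable (\<lambda>k. of_real (a k / fact k) * z ^ k :: complex)"
proof (rule summable_comparison_test'[where N = 0])
  show "summable (\<lambda>k. c * (inverse (fact k) * norm z ^ k))" by (intro summable_mult summable_exp)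
  show "norm (of_real (a k / fact k) * z ^ k) \<le> c * (inverse (fact k) * norm z ^ k)" for k
  proof -
    have "\<bar>a k\<bar> / fact k * norm z ^ k \<le> c / fact k * norm z ^ k"
      by (intro mult_right_mono divide_right_mono bounded) auto
    thus ?thesis unfolding norm_exp_gen_fun_term by (simp add: divide_inverse mult_ac)
  qed
qed

text \<open>After \<open>n\<close> vanishing coefficients a factor \<open>z ^ n\<close> splits off,
  and \<open>fact (k + n) \<ge> fact k\<close> bounds the rest by the exponential series.\<close>

lemma norm_exp_gen_fun_le:
  assumes "\<And>k. k < n \<Longrightarrow> a k = 0"
  shows "norm (exp_gen_fun a z) \<le> c * norm z ^ n * exp (norm z)"
proof -
  define b where "b k = of_real (a k / fact k) * z ^ k" for k
  have "c \<ge> 0" using bounded[of 0] by linarith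
  have "exp_gen_fun a z = (\<Sum>k. b (k + n)) + sum b {..<n}"
    unfolding exp_gen_fun_def b_def[symmetric] by (rule suminf_split_initial_segment) (use exp_gen_fun_summable in \<open>simp add: b_def\<close>)
  also have "sum b {..<n} = 0" using assms by (intro sum.neutral) (simp add: b_def)
  finally have "exp_gen_fun a z = (\<Sum>k. b (k + n))" by simp
  also have "norm \<dots> \<le> (\<Sum>k. c * norm z ^ n * (norm z ^ k /\<^sub>R fact k))"
  proof (rule norm_suminf_le)
    fix k
    have "\<bar>a (k + n)\<bar> / fact (k + n) \<le> c / fact k"
      using bounded[of "k + n"] \<open>c \<ge> 0\<close> by (intro frac_le fact_mono) auto
    hence "\<bar>a (k + n)\<bar> / fact (k + n) * norm z ^ (k + n) \<le> c / fact k * norm z ^ (k + n)"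
      by (rule mult_right_mono) simp
    thus "norm (b (k + n)) \<le> c * norm z ^ n * (norm z ^ k /\<^sub>R fact k)"
      unfolding b_def norm_exp_gen_fun_term by (simp add: power_add divide_inverse mult_ac)
  qed (intro summable_mult sums_summable[OF exp_converges])
  also have "\<dots> = c * norm z ^ n * exp (norm z)"
    by (intro sums_unique[symmetric] sums_mult exp_converges)
  finally show ?thesis .
qed

text \<open>Differentiation shifts the coefficient sequence, which stays bounded by the same
  \<open>c\<close>; hence the growth bound applies to the derivative as well.\<close>

lemma exp_gen_fun_has_field_derivative: "(exp_gen_fun a has_field_derivative exp_gen_fun (\<lambda>k. a (Suc k)) z) (at z)"
proof -
  have "diffs (\<lambda>k. of_real (a k / fact k)) k = (of_real (a (Suc k) / fact k) :: complex)" for k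
    by (simp add: diffs_def field_simps del: of_nat_Suc)
  thus ?thesis
    using termdiffs_strong_converges_everywhere[OF exp_gen_fun_summable, of z] by (simp add: exp_gen_fun_def[abs_def])
qed

lemma holomorphic_exp_gen_fun: "exp_gen_fun a holomorphic_on S"
  using exp_gen_fun_has_field_derivative by (meson field_differentiable_at_within field_differentiable_def holomorphic_on_def)

end

lemma exp_gen_fun_of_real:
  assumes "(\<lambda>k. a k / fact k * x ^ k) sums y"
  shows "exp_gen_fun a (of_real x) = of_real y"
  unfolding exp_gen_fun_def using sums_of_real[OF assms, where ?'a = complex] by (simp add: sums_iff)

text \<open>The remainder after order \<open>n\<close> is at most
  \<open>c * q ^ Suc n / fact n\<close> and tends to \<open>0\<close>. Geometric growth
  \<open>B ^ k\<close> is allowed because the derivatives of \<open>f\<close> grow in this way on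
  intervals away from \<open>0\<close>.\<close>

lemma taylor_sums:
  fixes D :: "nat \<Rightarrow> real \<Rightarrow> real"
  assumes "convex S" and deriv: "\<And>k x. x \<in> S \<Longrightarrow> (D k has_real_derivative D (Suc k) x) (at x within S)"
    and bound: "\<And>k x. x \<in> S \<Longrightarrow> \<bar>D k x\<bar> \<le> c * B ^ k" and "w \<in> S" "z \<in> S"
  shows "(\<lambda>k. D k w / fact k * (z - w) ^ k) sums D 0 z"
proof -
  define q where "q = B * \<bar>z - w\<bar>"
  have "(\<lambda>n. c * q * (q ^ n /\<^sub>R fact n)) \<longlonglongrightarrow> c * q * 0"
    by (intro tendsto_mult tendsto_const summable_LIMSEQ_zero sums_summable[OF exp_converges])
  hence lim: "(\<lambda>n. c * q * (q ^ n /\<^sub>R fact n)) \<longlonglongrightarrow> 0" by simp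
  have "(\<lambda>n. D 0 z - (\<Sum>k\<le>n. D k w / fact k * (z - w) ^ k)) \<longlonglongrightarrow> 0"
  proof (rule Lim_null_comparison[OF always_eventually[OF allI] lim])
    fix n
    have "norm (D 0 z - (\<Sum>k\<le>n. D k w * (z - w) ^ k / fact k)) \<le> c * B ^ Suc n * norm (z - w) ^ Suc n / fact n"
    proof (rule field_Taylor[OF assms(1)])
      show "norm (D (Suc n) x) \<le> c * B ^ Suc n" if "x \<in> S" for x
        using bound[OF that, of "Suc n"] by simp
    qed (use assms in auto)
    thus "norm (D 0 z - (\<Sum>k\<le>n. D k w / fact k * (z - w) ^ k)) \<le> c * q * (q ^ n /\<^sub>R fact n)"
      by (simp add: q_def power_mult_distrib divide_inverse mult_ac)
  qed
  from tendsto_diff[OF tendsto_const[of "D 0 z"] this] show ?thesis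
    unfolding sums_def_le by simp
qed

section \<open>Entire extensions of amplitude and phase\<close>

lemma smooth_on_has_derivative:
  assumes "smooth_on S f" "x \<in> S"
  shows "(nth_deriv S k f has_real_derivative nth_deriv S (Suc k) f x) (at x within S)"
  using assms
  by (auto simp: smooth_on_def differentiable_on_def has_real_derivative_iff_has_vector_derivative
      vector_derivative_works[symmetric])

lemma max_norm_ge:
  assumes "continuous_on {0..1} h" "x \<in> {0..1}"
  shows "\<bar>h x\<bar> \<le> max_norm h"
  unfolding max_norm_def
proof (rule cSUP_upper[OF assms(2)])
  have "compact ((\<lambda>x. \<bar>h x\<bar>) ` {0..1})"
    using assms(1) by (intro compact_continuous_image continuous_intros) auto
  thus "bdd_above ((\<lambda>x. \<bar>h x\<bar>) ` {0..1})" by (intro bounded_imp_bdd_above compact_imp_bounded)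
qed

text \<open>Expansion at \<open>1\<close>, where \<open>x powr (\<mu> - real k)\<close> equals
  \<open>1\<close> for every \<open>k\<close>, so all Taylor coefficients are bounded by
  \<open>c\<close>. The exponent is \<open>e = 0\<close> for \<open>\<mu> \<le> 0\<close> and
  \<open>e = 1\<close> otherwise.\<close>

lemma type_inf_0_entire_extension:
  assumes "type_inf_0 \<mu> f" "\<mu> < 1"
  obtains F :: "complex \<Rightarrow> complex" and C :: real and e :: nat
  where "F holomorphic_on UNIV" "\<And>x. x \<in> {0<..1} \<Longrightarrow> F (of_real x) = of_real (f x)"
    "C > 0" "\<mu> \<le> real e" "e \<le> 1" "\<And>z. norm (F z) \<le> C * norm z ^ e * exp (norm z)"
proof -
  define D where "D k = nth_deriv {0<..1} k f" for k
  obtain c where "c > 0" and smooth: "smooth_on {0<..1} f"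
    and c: "\<And>x k. x \<in> {0<..1} \<Longrightarrow> \<bar>D k x\<bar> \<le> c * x powr (\<mu> - real k)"
    using assms(1) by (auto simp: type_inf_0_def D_def)
  define a where "a k = D k 1" for k
  have a: "\<bar>a k\<bar> \<le> c" for k using c[of 1 k] by (simp add: a_def)
  define F where "F z = exp_gen_fun a (z - 1)" for z
  have F': "(F has_field_derivative exp_gen_fun (\<lambda>k. a (Suc k)) (z - 1)) (at z)" for z
  proof -
    have "((\<lambda>z. z - 1) has_field_derivative 1) (at z)" by (auto intro!: derivative_eq_intros)
    from DERIV_chain2[OF exp_gen_fun_has_field_derivative[where a = a, OF a] this] show ?thesis
      by (simp add: F_def[abs_def])
  qed
  have holo: "F holomorphic_on UNIV"
    using F' by (meson field_differentiable_at_within field_differentiable_def holomorphic_on_def)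
  have F_real: "F (of_real x) = of_real (f x)" if x: "x \<in> {0<..1}" for x
  proof -
    \<comment> \<open>On \<open>[x,1]\<close> the bound on \<open>D k y\<close> splits into
      \<open>y powr \<mu>\<close>, which is largest at one of the two ends, and
      \<open>(1 / y) ^ k \<le> (1 / x) ^ k\<close>; this gives \<open>c\<close> and
      \<open>B\<close>.\<close>
    have "(\<lambda>k. D k 1 / fact k * (x - 1) ^ k) sums D 0 x"
    proof (rule taylor_sums[where S = "{x..1}" and B = "1 / x" and c = "c * max 1 (x powr \<mu>)"])
      fix k y assume y: "y \<in> {x..1}"
      thus "(D k has_real_derivative D (Suc k) y) (at y within {x..1})"
        unfolding D_def using x by (intro DERIV_subset[OF smooth_on_has_derivative[OF smooth]]) auto
      have "\<bar>D k y\<bar> \<le> c * y powr (\<mu> - real k)" using x y by (intro c) auto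
      also have "y powr (\<mu> - real k) = y powr \<mu> * (1 / y) ^ k"
        using x y by (simp add: powr_diff powr_realpow power_divide)
      also have "\<dots> \<le> max 1 (x powr \<mu>) * (1 / x) ^ k"
      proof (intro mult_mono power_mono frac_le)
        show "y powr \<mu> \<le> max 1 (x powr \<mu>)"
        proof (cases "\<mu> \<ge> 0")
          case True
          hence "y powr \<mu> \<le> 1 powr \<mu>" using x y by (intro powr_mono2) auto
          thus ?thesis by simp
        next
          case False
          hence "y powr \<mu> \<le> x powr \<mu>" using x y by (intro powr_mono2') auto
          thus ?thesis by simp
        qed
      qed (use x y in auto)
      finally show "\<bar>D k y\<bar> \<le> c * max 1 (x powr \<mu>) * (1 / x) ^ k" using \<open>c > 0\<close> by simp
    qed (use x in auto)
    hence "exp_gen_fun a (of_real (x - 1)) = of_real (D 0 x)" by (intro exp_gen_fun_of_real) (simp add: a_def)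
    thus ?thesis by (simp add: F_def D_def)
  qed
  have shift_le: "c * exp (norm (z - 1)) \<le> c * exp 1 * exp (norm z)" for z :: complex
    using norm_triangle_ineq4[of z 1] \<open>c > 0\<close> by (simp add: mult.commute flip: exp_add)
  show thesis
  proof (cases "\<mu> \<le> 0")
    case True
    have "norm (F z) \<le> c * exp 1 * norm z ^ 0 * exp (norm z)" for z
      using norm_exp_gen_fun_le[where a = a and n = 0 and z = "z - 1", OF a] shift_le[of z] by (simp add: F_def)
    thus thesis using True \<open>c > 0\<close> by (intro that[OF holo F_real, of "c * exp 1" 0]) auto
  next
    case False
    \<comment> \<open>Since \<open>e\<close> is an integer, \<open>\<mu> > 0\<close> forces \<open>e = 1\<close>: the bound \<open>c * x powr \<mu>\<close> makes \<open>F\<close> vanish at \<open>0\<close>.\<close>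
    have "F 0 = 0"
    proof -
      have "((\<lambda>x. c * x powr \<mu>) \<longlongrightarrow> c * 0 powr \<mu>) (at_right 0)"
        using False by (intro tendsto_intros tendsto_powr') (auto simp: eventually_at_right_less intro!: eventually_at_rightI[of 0 1])
      hence "((\<lambda>x. c * x powr \<mu>) \<longlongrightarrow> 0) (at_right 0)" by simp
      moreover have "\<forall>\<^sub>F x in at_right 0. norm (F (of_real x)) \<le> c * x powr \<mu>"
        using c[of _ 0] by (intro eventually_at_rightI[of 0 1]) (auto simp: F_real D_def)
      ultimately have "((\<lambda>x. F (of_real x)) \<longlongrightarrow> 0) (at_right 0)" by (rule Lim_null_comparison[rotated])
      moreover have "((\<lambda>x. F (of_real x)) \<longlongrightarrow> F (of_real 0)) (at_right 0)"
        by (rule isCont_tendsto_compose[OF DERIV_isCont[OF F']]) (intro tendsto_intros)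
      ultimately show ?thesis using tendsto_unique trivial_limit_at_right_real by fastforce
    qed
    have "norm (F z) \<le> c * exp 1 * norm z ^ 1 * exp (norm z)" for z
    proof -
      \<comment> \<open>The mean value inequality on the disc of radius \<open>norm z\<close> turns
        the zero at \<open>0\<close> into a factor \<open>norm z\<close>.\<close>
      have "norm (F z - F 0) \<le> c * exp 1 * exp (norm z) * norm (z - 0)"
      proof (rule field_differentiable_bound[OF convex_cball])
        show "(F has_field_derivative exp_gen_fun (\<lambda>k. a (Suc k)) (w - 1)) (at w within cball 0 (norm z))" for w
          by (rule has_field_derivative_at_within[OF F'])
        fix w :: complex assume "w \<in> cball 0 (norm z)"
        hence "c * exp 1 * exp (norm w) \<le> c * exp 1 * exp (norm z)"
          using \<open>c > 0\<close> by simp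
        thus "norm (exp_gen_fun (\<lambda>k. a (Suc k)) (w - 1)) \<le> c * exp 1 * exp (norm z)"
          using norm_exp_gen_fun_le[where a = "\<lambda>k. a (Suc k)" and n = 0 and z = "w - 1", OF a] shift_le[of w] by simp
      qed auto
      thus ?thesis using \<open>F 0 = 0\<close> by (simp add: mult_ac)
    qed
    thus thesis using assms(2) \<open>c > 0\<close> by (intro that[OF holo F_real, of "c * exp 1" 1]) auto
  qed
qed

text \<open>Expansion at \<open>0\<close>: the bound \<open>\<zeta>\<close> is the same for all
  orders, so \<open>taylor_sums\<close> applies with \<open>B = 1\<close>, and the first
  \<open>n\<close> coefficients vanish.\<close>

lemma phase_entire_extension:
  assumes smooth: "smooth_on {0..1} g" and zero: "\<And>j. j < n \<Longrightarrow> nth_deriv {0..1} j g 0 = 0"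
    and bound: "\<And>j. max_norm (nth_deriv {0..1} j g) \<le> \<zeta>"
  obtains G :: "complex \<Rightarrow> complex"
  where "G holomorphic_on UNIV" "\<And>x. x \<in> {0..1} \<Longrightarrow> G (of_real x) = of_real (g x)"
    "\<And>z. norm (G z) \<le> \<zeta> * norm z ^ n * exp (norm z)"
proof -
  define D where "D k = nth_deriv {0..1} k g" for k
  have deriv: "(D k has_real_derivative D (Suc k) x) (at x within {0..1})" if "x \<in> {0..1}" for k x
    unfolding D_def by (rule smooth_on_has_derivative[OF smooth that])
  have D: "\<bar>D k x\<bar> \<le> \<zeta>" if "x \<in> {0..1}" for k x
    using order_trans[OF max_norm_ge[OF DERIV_continuous_on[OF deriv] that] bound[folded D_def]] .
  define a where "a k = D k 0" for k
  have a: "\<bar>a k\<bar> \<le> \<zeta>" for k using D by (simp add: a_def)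
  show thesis
  proof
    show "exp_gen_fun a holomorphic_on UNIV" by (rule holomorphic_exp_gen_fun[where a = a, OF a])
    show "norm (exp_gen_fun a z) \<le> \<zeta> * norm z ^ n * exp (norm z)" for z
      by (rule norm_exp_gen_fun_le[where a = a, OF a]) (simp add: a_def D_def zero)
    fix x :: real assume x: "x \<in> {0..1}"
    have "(\<lambda>k. D k 0 / fact k * (x - 0) ^ k) sums D 0 x"
      by (rule taylor_sums[where S = "{0..1}" and B = 1 and c = \<zeta>]) (use x deriv D in auto)
    hence "exp_gen_fun a (of_real x) = of_real (D 0 x)" by (intro exp_gen_fun_of_real) (simp add: a_def)
    thus "exp_gen_fun a (of_real x) = of_real (g x)" by (simp add: D_def)
  qed
qed

section \<open>The oscillatory integral\<close>

text \<open>In both branches \<open>kappa_sigma\<close> is at least \<open>\<kappa>\<close>, and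
  \<open>lambda ^ (r + 1)\<close> is its reciprocal.\<close>

lemma lambda_bounds:
  assumes "\<kappa> > 1"
  shows "0 < lambda g r \<kappa>" "lambda g r \<kappa> \<le> 1" "\<kappa> * lambda g r \<kappa> ^ (r + 1) \<le> 1"
    "lambda g r \<kappa> powr p = kappa_sigma g r \<kappa> powr (- p / real (r + 1))"
proof -
  define K where "K = kappa_sigma g r \<kappa>"
  have K: "\<kappa> \<le> K" using assms by (simp add: K_def kappa_sigma_def)
  have lam: "lambda g r \<kappa> = K powr (- 1 / real (r + 1))" by (simp add: lambda_def K_def)
  show pos: "0 < lambda g r \<kappa>" using K assms by (simp add: lam)
  have "K powr (- 1 / real (r + 1)) \<le> K powr 0" using K assms by (intro powr_mono) (auto simp: field_simps)
  thus "lambda g r \<kappa> \<le> 1" using K assms by (simp add: lam)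
  show powr: "lambda g r \<kappa> powr p = kappa_sigma g r \<kappa> powr (- p / real (r + 1))" for p
    by (simp add: lam powr_powr K_def)
  have "lambda g r \<kappa> ^ (r + 1) = lambda g r \<kappa> powr real (r + 1)" by (rule powr_realpow[OF pos, symmetric])
  also have "- real (r + 1) / real (r + 1) = -1" by (simp add: field_simps)
  hence "lambda g r \<kappa> powr real (r + 1) = K powr (-1)" by (simp only: powr K_def)
  finally have eq: "lambda g r \<kappa> ^ (r + 1) = 1 / K" using K assms by (simp add: powr_minus field_simps)
  show "\<kappa> * lambda g r \<kappa> ^ (r + 1) \<le> 1" unfolding eq using K assms by (simp add: field_simps)
qed

text \<open>The derivative of \<open>g\<close> is \<open>1\<close> at \<open>0\<close>, which
  excludes \<open>r \<ge> 1\<close>; then \<open>sigma\<close> equals \<open>1\<close> and falls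
  into the branch that leaves \<open>\<kappa>\<close> unchanged.\<close>

lemma kappa_sigma_identity:
  assumes "smooth_on {0..1} g" "\<forall>j\<le>r. nth_deriv {0..1} j g 0 = 0" "\<forall>x\<in>{0..1}. g x = x"
  shows "r = 0" "kappa_sigma g r \<kappa> = \<kappa>"
proof -
  have deriv: "nth_deriv {0..1} 1 g x = 1" if x: "x \<in> {0..1}" for x
  proof -
    have "((\<lambda>x. x) has_vector_derivative 1) (at x within {0..1})" by (rule has_vector_derivative_id)
    hence "(g has_vector_derivative 1) (at x within {0..1})"
      by (rule has_vector_derivative_transform[rotated 2]) (use x assms(3) in auto)
    thus ?thesis using x vector_derivative_within_cbox[of 0 1 x g 1] by simp
  qed
  show "r = 0"
  proof (rule ccontr)
    assume "r \<noteq> 0"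
    hence "nth_deriv {0..1} 1 g 0 = 0" using assms(2)[rule_format, of 1] by simp
    thus False using deriv[of 0] by simp
  qed
  have "max_norm (nth_deriv {0..1} 1 g) = (SUP x\<in>{0..1::real}. 1)"
    unfolding max_norm_def using deriv by (intro SUP_cong) auto
  hence "sigma g r = 1" using \<open>r = 0\<close> by (simp add: sigma_def)
  thus "kappa_sigma g r \<kappa> = \<kappa>" by (simp add: kappa_sigma_def)
qed

theorem theorem5p6:
  fixes \<gamma> \<epsilon> \<mu> \<zeta> :: real and r :: nat and f g :: "real \<Rightarrow> real"
  assumes "0 < \<gamma>" "\<gamma> < 1" "1 \<le> \<epsilon>"
    and "-1 < \<mu>" "\<mu> < 1"
    and "type_inf_0 \<mu> f"
    and "smooth_on {0..1} g"
    and "\<forall>j\<le>r. nth_deriv {0..1} j g 0 = 0"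
    and "\<forall>x\<in>{0..1}. nth_deriv {0..1} (r + 1) g x \<noteq> 0"
    and "mono_on {0..1} g"
    and "no_inflection g"
    and "1 < \<zeta>"
    and "\<forall>n\<ge>1. (MAX j\<in>{0..n}. max_norm (nth_deriv {0..1} j g)) \<le> \<zeta>"
  shows "\<exists>c>0.
    (\<forall>\<kappa>>1. \<forall>s>1.
       cmod (osc_integral f g r \<kappa> - osc_quadrature \<gamma> \<epsilon> s f g r \<kappa>)
         \<le> c * kappa_sigma g r \<kappa> powr (- (1 + \<mu>) / real (r + 1))
             * \<gamma> powr ((1 + \<mu>) * (real s - 1) - 1)
       \<and> int (num_evals (composite_rule \<gamma> \<epsilon> s)) \<le> \<lceil>\<epsilon>\<rceil> * ((int s)\<^sup>2 - int s))
    \<and> ((\<forall>x\<in>{0..1}. g x = x) \<longrightarrow>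
       (\<forall>\<kappa>>1. \<forall>s>1.
          c * kappa_sigma g r \<kappa> powr (- (1 + \<mu>) / real (r + 1))
              * \<gamma> powr ((1 + \<mu>) * (real s - 1) - 1)
            = c * \<kappa> powr (-1 - \<mu>) * \<gamma> powr ((1 + \<mu>) * (real s - 1) - 1)
          \<and> cmod (osc_integral f g r \<kappa> - osc_quadrature \<gamma> \<epsilon> s f g r \<kappa>)
            \<le> c * \<kappa> powr (-1 - \<mu>) * \<gamma> powr ((1 + \<mu>) * (real s - 1) - 1)))"
proof -
  note \<gamma> = assms(1,2)
  obtain F :: "complex \<Rightarrow> complex" and C :: real and e :: nat
    where F: "F holomorphic_on UNIV" "\<And>x. x \<in> {0<..1} \<Longrightarrow> F (of_real x) = of_real (f x)"
      "C > 0" "\<mu> \<le> real e" "e \<le> 1" "\<And>z. norm (F z) \<le> C * norm z ^ e * exp (norm z)"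
    using type_inf_0_entire_extension[OF assms(6,5)] by blast
  have "max_norm (nth_deriv {0..1} j g) \<le> \<zeta>" for j
  proof -
    \<comment> \<open>The maximum bound is given for \<open>n \<ge> 1\<close>; taking
      \<open>n = Suc j\<close> covers \<open>j = 0\<close> too.\<close>
    have "max_norm (nth_deriv {0..1} j g) \<le> (MAX j\<in>{0..Suc j}. max_norm (nth_deriv {0..1} j g))"
      by (intro Max_ge) auto
    also have "\<dots> \<le> \<zeta>" using assms(13) by auto
    finally show ?thesis .
  qed
  then obtain G :: "complex \<Rightarrow> complex"
    where G: "G holomorphic_on UNIV" "\<And>x. x \<in> {0..1} \<Longrightarrow> G (of_real x) = of_real (g x)"
      "\<And>z. norm (G z) \<le> \<zeta> * norm z ^ (r + 1) * exp (norm z)"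
    using phase_entire_extension[OF assms(7), of "r + 1" \<zeta>] assms(8) by (metis less_Suc_eq_le Suc_eq_plus1)
  \<comment> \<open>Discs of radius \<open>1 / \<gamma> ^ 3\<close> about points of \<open>[0,1]\<close> lie in the disc of radius \<open>\<rho>\<close> about \<open>0\<close>.\<close>
  define \<rho> where "\<rho> = 1 + 1 / \<gamma> ^ 3"
  have "\<rho> \<ge> 1" using \<gamma> by (simp add: \<rho>_def)
  \<comment> \<open>The factor \<open>C * exp \<rho>\<close> comes from the growth of
    \<open>F\<close>, the last one from the bound on the exponent \<open>\<i> \<kappa> G\<close>. In
    \<open>c\<close> below, \<open>1\<close> accounts for the omitted cell and
    \<open>2 / (1 - \<gamma>)\<close> for the others.\<close>
  define A where "A = C * exp \<rho> * exp (\<zeta> * \<rho> ^ (r + 1) * exp \<rho>)"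
  have "A > 0" using \<open>C > 0\<close> by (simp add: A_def)
  define c where "c = A * \<rho> ^ e * (1 + 2 / (1 - \<gamma>))"
  have "c > 0" using \<open>A > 0\<close> \<open>\<rho> \<ge> 1\<close> \<gamma> by (simp add: c_def add_pos_nonneg)
  have error: "cmod (osc_integral f g r \<kappa> - osc_quadrature \<gamma> \<epsilon> s f g r \<kappa>)
       \<le> c * kappa_sigma g r \<kappa> powr (- (1 + \<mu>) / real (r + 1)) * \<gamma> powr ((1 + \<mu>) * (real s - 1) - 1)"
    if "\<kappa> > 1" "s > 1" for \<kappa> s
  proof -
    define \<l> where "\<l> = lambda g r \<kappa>"
    note \<l> = lambda_bounds[OF \<open>\<kappa> > 1\<close>, of g r, folded \<l>_def]
    define \<Phi> where "\<Phi> z = F (of_real \<l> * z) * exp (\<i> * (of_real \<kappa> * G (of_real \<l> * z)))" for z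
    have holo: "\<Phi> holomorphic_on UNIV" unfolding \<Phi>_def
      by (intro holomorphic_intros holomorphic_on_compose_gen[OF _ F(1), unfolded o_def]
            holomorphic_on_compose_gen[OF _ G(1), unfolded o_def]) auto
    have \<Phi>_real: "phi f g r \<kappa> x = \<Phi> (of_real x)" if x: "x \<in> {0<..1}" for x
    proof -
      have "\<l> * x \<in> {0<..1}" using x \<l>(1,2) by (auto intro: mult_le_one)
      thus ?thesis using F(2)[of "\<l> * x"] G(2)[of "\<l> * x"] by (simp add: phi_def \<Phi>_def \<l>_def)
    qed
    have \<Phi>_le: "norm (\<Phi> z) \<le> A * \<l> ^ e * norm z ^ e" if z: "norm z \<le> \<rho>" for z
    proof -
      have norm_lz: "norm (of_real \<l> * z) = \<l> * norm z" using \<l>(1) by (simp add: norm_mult)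
      have "\<l> * norm z \<le> 1 * norm z" using \<l> by (intro mult_right_mono) auto
      hence exp_le: "exp (\<l> * norm z) \<le> exp \<rho>" using z by simp
      \<comment> \<open>The zero of order \<open>r + 1\<close> of the phase absorbs \<open>\<kappa>\<close>, because \<open>\<kappa> \<l> ^ (r + 1) \<le> 1\<close>.\<close>
      have "\<kappa> * norm (G (of_real \<l> * z)) \<le> \<kappa> * (\<zeta> * (\<l> * norm z) ^ (r + 1) * exp (\<l> * norm z))"
        using G(3)[of "of_real \<l> * z"] \<open>\<kappa> > 1\<close> unfolding norm_lz by (intro mult_left_mono) auto
      also have "\<dots> = (\<kappa> * \<l> ^ (r + 1)) * (\<zeta> * norm z ^ (r + 1) * exp (\<l> * norm z))"
        by (simp add: power_mult_distrib mult_ac)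
      also have "\<dots> \<le> 1 * (\<zeta> * \<rho> ^ (r + 1) * exp \<rho>)"
        using \<l>(1,3) exp_le z assms(12) \<open>\<kappa> > 1\<close> \<open>\<rho> \<ge> 1\<close> by (intro mult_mono power_mono) auto
      finally have "norm (\<i> * (of_real \<kappa> * G (of_real \<l> * z))) \<le> \<zeta> * \<rho> ^ (r + 1) * exp \<rho>"
        using \<open>\<kappa> > 1\<close> by (simp add: norm_mult)
      hence "norm (exp (\<i> * (of_real \<kappa> * G (of_real \<l> * z)))) \<le> exp (\<zeta> * \<rho> ^ (r + 1) * exp \<rho>)"
        by (intro order_trans[OF norm_exp]) simp
      moreover have "norm (F (of_real \<l> * z)) \<le> C * (\<l> * norm z) ^ e * exp \<rho>"
        using F(6)[of "of_real \<l> * z"] exp_le \<open>C > 0\<close> \<l>(1) unfolding norm_lz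
        by (elim order_trans) (intro mult_left_mono, auto)
      ultimately have "norm (\<Phi> z) \<le> C * (\<l> * norm z) ^ e * exp \<rho> * exp (\<zeta> * \<rho> ^ (r + 1) * exp \<rho>)"
        unfolding \<Phi>_def norm_mult using \<open>C > 0\<close> \<l>(1) by (intro mult_mono) auto
      thus ?thesis by (simp add: A_def power_mult_distrib mult_ac)
    qed
    define M where "M = A * \<l> ^ e * \<rho> ^ e"
    have Al: "A * \<l> ^ e \<ge> 0" using \<open>A > 0\<close> \<l>(1) by simp
    have "M \<ge> 0" using Al \<open>\<rho> \<ge> 1\<close> by (simp add: M_def)
    have "norm (integral {0..1} (\<lambda>x. \<Phi> (of_real x)) - apply_quadrature (composite_rule \<gamma> \<epsilon> s) (\<lambda>x. \<Phi> (of_real x)))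
             \<le> M * \<gamma> ^ ((s - 1) * (e + 1)) + 2 * M * \<gamma> ^ (2 * (s - 1)) / (1 - \<gamma>)"
    proof (rule composite_error[OF \<gamma> assms(3) \<open>s > 1\<close> holo])
      fix z :: complex assume "norm z \<le> 1 + 1 / \<gamma> ^ 3"
      hence z: "norm z \<le> \<rho>" by (simp add: \<rho>_def)
      have "A * \<l> ^ e * norm z ^ e \<le> M"
        unfolding M_def using z Al by (intro mult_left_mono power_mono) auto
      thus "norm (\<Phi> z) \<le> M" using \<Phi>_le[OF z] by linarith
    next
      fix x :: real assume x: "0 \<le> x" "x \<le> 1"
      have "A * \<l> ^ e \<le> M" using mult_left_mono[OF one_le_power[OF \<open>\<rho> \<ge> 1\<close>] Al, of e] by (simp add: M_def)
      hence "A * \<l> ^ e * x ^ e \<le> M * x ^ e" using x by (intro mult_right_mono) auto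
      thus "norm (\<Phi> (of_real x)) \<le> M * x ^ e"
        using \<Phi>_le[of "of_real x"] x \<open>\<rho> \<ge> 1\<close> by simp
    qed
    \<comment> \<open>Since \<open>e \<le> 1\<close>, the power from the Gauss cells is no larger
      than that from the omitted cell.\<close>
    also have "\<dots> \<le> M * \<gamma> ^ ((s - 1) * (e + 1)) + 2 * M * \<gamma> ^ ((s - 1) * (e + 1)) / (1 - \<gamma>)"
      using \<open>M \<ge> 0\<close> \<gamma> \<open>e \<le> 1\<close>
      by (intro add_left_mono divide_right_mono mult_left_mono power_decreasing) (auto simp: mult.commute)
    also have "\<dots> = c * \<l> ^ e * \<gamma> ^ ((s - 1) * (e + 1))"
      by (simp add: c_def M_def algebra_simps)
    finally have main: "norm (integral {0..1} (\<lambda>x. \<Phi> (of_real x)) - apply_quadrature (composite_rule \<gamma> \<epsilon> s) (\<lambda>x. \<Phi> (of_real x)))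
             \<le> c * \<l> ^ e * \<gamma> ^ ((s - 1) * (e + 1))" .
    \<comment> \<open>\<open>phi\<close> and \<open>\<Phi>\<close> may differ at \<open>0\<close>,
      where \<open>f\<close> is arbitrary; this is a null set and contains no node.\<close>
    have "integral {0..1} (phi f g r \<kappa>) = integral {0..1} (\<lambda>x. \<Phi> (of_real x))"
      by (rule integral_spike[of "{0}"]) (auto simp: \<Phi>_real)
    moreover have "apply_quadrature (composite_rule \<gamma> \<epsilon> s) (phi f g r \<kappa>)
        = apply_quadrature (composite_rule \<gamma> \<epsilon> s) (\<lambda>x. \<Phi> (of_real x))"
      by (rule apply_quadrature_cong) (use \<Phi>_real composite_rule_nodes[OF \<gamma>] in blast)
    ultimately have "osc_integral f g r \<kappa> - osc_quadrature \<gamma> \<epsilon> s f g r \<kappa>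
        = of_real \<l> * (integral {0..1} (\<lambda>x. \<Phi> (of_real x)) - apply_quadrature (composite_rule \<gamma> \<epsilon> s) (\<lambda>x. \<Phi> (of_real x)))"
      by (simp add: osc_integral_def osc_quadrature_def \<l>_def right_diff_distrib)
    hence "cmod (osc_integral f g r \<kappa> - osc_quadrature \<gamma> \<epsilon> s f g r \<kappa>) \<le> \<l> * (c * \<l> ^ e * \<gamma> ^ ((s - 1) * (e + 1)))"
      using mult_left_mono[OF main less_imp_le[OF \<l>(1)]] \<l>(1) by (simp add: norm_mult)
    also have "\<dots> = c * \<l> powr (1 + real e) * \<gamma> powr real ((s - 1) * (e + 1))"
      using \<l>(1) \<gamma> by (simp add: powr_realpow powr_add mult_ac del: of_nat_mult of_nat_add)
    \<comment> \<open>Both bases lie in \<open>(0,1]\<close> and \<open>\<mu> \<le> e\<close>, so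
      lowering the exponents enlarges the powers.\<close>
    also have "\<dots> \<le> c * \<l> powr (1 + \<mu>) * \<gamma> powr ((1 + \<mu>) * (real s - 1) - 1)"
    proof (intro mult_mono powr_mono')
      have "(1 + \<mu>) * (real s - 1) \<le> (1 + real e) * (real s - 1)"
        using F(4) \<open>s > 1\<close> by (intro mult_right_mono) auto
      moreover have "real ((s - 1) * (e + 1)) = (1 + real e) * (real s - 1)"
        unfolding of_nat_mult using \<open>s > 1\<close> by (simp add: of_nat_diff)
      ultimately show "(1 + \<mu>) * (real s - 1) - 1 \<le> real ((s - 1) * (e + 1))" by linarith
    qed (use F(4) \<l>(1,2) \<gamma> \<open>c > 0\<close> in auto)
    finally show ?thesis by (simp only: \<l>(4))
  qed
  show ?thesis
  proof (intro exI[of _ c] conjI allI impI)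
    fix \<kappa> :: real and s :: nat
    assume id: "\<forall>x\<in>{0..1}. g x = x" and "\<kappa> > 1" "s > 1"
    note kappa = kappa_sigma_identity[OF assms(7,8) id]
    show eq: "c * kappa_sigma g r \<kappa> powr (- (1 + \<mu>) / real (r + 1)) * \<gamma> powr ((1 + \<mu>) * (real s - 1) - 1)
        = c * \<kappa> powr (-1 - \<mu>) * \<gamma> powr ((1 + \<mu>) * (real s - 1) - 1)"
      unfolding kappa(2) by (simp add: kappa(1))
    show "cmod (osc_integral f g r \<kappa> - osc_quadrature \<gamma> \<epsilon> s f g r \<kappa>)
        \<le> c * \<kappa> powr (-1 - \<mu>) * \<gamma> powr ((1 + \<mu>) * (real s - 1) - 1)"
      using error[OF \<open>\<kappa> > 1\<close> \<open>s > 1\<close>] unfolding eq .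
  qed (use \<open>c > 0\<close> error num_evals_composite_rule[OF assms(3)] in auto)
qed

end
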